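(* If $S\subseteq\mathbb S$ is countably determined, then a typical compact space $K\in\mathcal K_{\mathsf{GH}}$ is $S$-dominated; i.e., the set of all $K\in\mathcal K_{\mathsf{GH}}$ that are $S$-dominated is comeager in $(\mathcal K_{\mathsf{GH}},d_{\mathsf{GH}})$.
   Context: $\mathbb S$ is the set of all strictly decreasing sequences $s=(s_n)_{n\geq1}$ of positive reals converging to $0$. For $s,s'\in\mathbb S$, $s\leq s'$ means $s_n\leq s'_n$ for all $n$. For $S,S'\subseteq\mathbb S$ write $S'\leq S$ if for every $s\in S$ there is $s'\in S'$ with $s'\leq s$; $S$ is countably determined if there is a countable $S'\subseteq\mathbb S$ with $S'\leq S$ and $S\leq S'$. A metric space $K$ is $S$-dominated if for each $s\in S$ there is a sequence $(E_n)_{n\geq1}$ of subsets of $K$ that covers $K$ and satisfies $\operatorname{diam}E_n<s_n$ for all $n$. $\mathcal K_{\mathsf{GH}}$ is the Gromov–Hausdorff space, i.e. the space of all (isometry classes of) nonempty compact metric spaces with the Gromov–Hausdorff metric $d_{\mathsf{GH}}$. A set is meager if it is a countable union of nowhere dense sets, and comeager if its complement is meager. *)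

theory Defs
  imports "HOL-Analysis.Analysis"
begin

section \<open>Null sequences and domination\<close>

text \<open>Sequences \<open>(s\<^sub>n)\<close> with \<open>n \<ge> 1\<close> are functions on \<open>nat\<close> shifted by one: \<open>s n\<close> stands for the term of
  index \<open>n + 1\<close>. The order \<open>s \<le> s'\<close> is the pointwise order on functions.\<close>

definition null_seqs :: "(nat \<Rightarrow> real) set" where
  "null_seqs = {s. (\<forall>n. s (Suc n) < s n) \<and> (\<forall>n. 0 < s n) \<and> s \<longlonglongrightarrow> 0}"

definition finer_family :: "(nat \<Rightarrow> real) set \<Rightarrow> (nat \<Rightarrow> real) set \<Rightarrow> bool" where
  "finer_family S' S \<longleftrightarrow> (\<forall>s\<in>S. \<exists>s'\<in>S'. s' \<le> s)"

definition countably_determined :: "(nat \<Rightarrow> real) set \<Rightarrow> bool" where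
  "countably_determined S \<longleftrightarrow>
     (\<exists>S'. S' \<subseteq> null_seqs \<and> countable S' \<and> finer_family S' S \<and> finer_family S S')"

text \<open>The value lies in \<open>ennreal\<close>, so that unbounded sets have diameter \<open>\<infinity>\<close> and the empty set has
  diameter \<open>0\<close>.\<close>

definition mdiam :: "'a metric \<Rightarrow> 'a set \<Rightarrow> ennreal" where
  "mdiam K E = (SUP x\<in>E. SUP y\<in>E. ennreal (mdist K x y))"

definition seq_dominated :: "(nat \<Rightarrow> real) set \<Rightarrow> 'a metric \<Rightarrow> bool" where
  "seq_dominated S K \<longleftrightarrow>
     (\<forall>s\<in>S. \<exists>E :: nat \<Rightarrow> 'a set. (\<forall>n. E n \<subseteq> mspace K) \<and> (\<Union>n. E n) = mspace K \<and>
        (\<forall>n. mdiam K (E n) < ennreal (s n)))"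


section \<open>Category\<close>

definition nowhere_dense :: "'a::topological_space set \<Rightarrow> bool" where
  "nowhere_dense A \<longleftrightarrow> interior (closure A) = {}"

definition meager :: "'a::topological_space set \<Rightarrow> bool" where
  "meager A \<longleftrightarrow> (\<exists>F :: nat \<Rightarrow> 'a set. (\<forall>n. nowhere_dense (F n)) \<and> A = (\<Union>n. F n))"

definition comeager :: "'a::topological_space set \<Rightarrow> bool" where
  "comeager A \<longleftrightarrow> meager (- A)"


section \<open>The Gromov--Hausdorff distance\<close>

definition isometric_embedding :: "'a metric \<Rightarrow> 'b metric \<Rightarrow> ('a \<Rightarrow> 'b) \<Rightarrow> bool" where
  "isometric_embedding X Y f \<longleftrightarrow> f \<in> mspace X \<rightarrow> mspace Y \<and>
     (\<forall>x\<in>mspace X. \<forall>x'\<in>mspace X. mdist Y (f x) (f x') = mdist X x x')"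

definition isometric :: "'a metric \<Rightarrow> 'b metric \<Rightarrow> bool" where
  "isometric X Y \<longleftrightarrow> (\<exists>f. isometric_embedding X Y f \<and> f ` mspace X = mspace Y)"

definition hausdorff_dist :: "'a metric \<Rightarrow> 'a set \<Rightarrow> 'a set \<Rightarrow> real" where
  "hausdorff_dist Z A B = Inf {r. 0 \<le> r \<and> (\<forall>a\<in>A. \<exists>b\<in>B. mdist Z a b \<le> r) \<and>
     (\<forall>b\<in>B. \<exists>a\<in>A. mdist Z a b \<le> r)}"

text \<open>A compact metric space has at most the cardinality of the continuum, so every one is isometric to
  a metric on a set of real numbers (the metric being unrelated to the usual one). Likewise, an ambient
  space of \<open>X\<close> and \<open>Y\<close> may be cut down to the union of their images, so that letting the ambient
  space \<open>Z\<close> range over the metrics on sets of reals does not change the infimum.\<close>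

definition gh_dist :: "real metric \<Rightarrow> real metric \<Rightarrow> real" where
  "gh_dist X Y = Inf {hausdorff_dist Z (f ` mspace X) (g ` mspace Y) | (Z :: real metric) f g.
     isometric_embedding X Z f \<and> isometric_embedding Y Z g}"

definition compact_metric :: "'a metric \<Rightarrow> bool" where
  "compact_metric X \<longleftrightarrow> mspace X \<noteq> {} \<and> compact_space (mtopology_of X)"

definition gh_rel :: "real metric \<Rightarrow> real metric \<Rightarrow> bool" where
  "gh_rel X Y \<longleftrightarrow> compact_metric X \<and> compact_metric Y \<and> isometric X Y"


subsection \<open>Isometries\<close>

lemma isometric_embedding_comp:
  assumes "isometric_embedding X Y f" "isometric_embedding Y Z g"
  shows "isometric_embedding X Z (g \<circ> f)"
  using assms unfolding isometric_embedding_def by (auto simp: Pi_iff)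

lemma isometric_embedding_inj:
  assumes "isometric_embedding X Y f"
  shows "inj_on f (mspace X)"
proof (rule inj_onI)
  fix x y assume xy: "x \<in> mspace X" "y \<in> mspace X" "f x = f y"
  have "mdist X x y = mdist Y (f x) (f y)"
    using assms xy(1,2) unfolding isometric_embedding_def by auto
  also have "\<dots> = 0"
    using assms xy unfolding isometric_embedding_def by (auto simp: Pi_iff)
  finally show "x = y" using xy by simp
qed

lemma isometric_refl: "isometric X X"
  unfolding isometric_def isometric_embedding_def by (rule exI[of _ id]) auto

lemma isometric_sym:
  assumes "isometric X Y" shows "isometric Y X"
proof -
  obtain f where f: "isometric_embedding X Y f" "f ` mspace X = mspace Y"
    using assms unfolding isometric_def by blast
  let ?g = "inv_into (mspace X) f"
  have inv: "?g y \<in> mspace X" "f (?g y) = y" if "y \<in> mspace Y" for y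
    using that f(2) by (auto simp: inv_into_into f_inv_into_f)
  have "isometric_embedding Y X ?g"
    unfolding isometric_embedding_def
  proof (intro conjI ballI)
    fix y y' assume y: "y \<in> mspace Y" "y' \<in> mspace Y"
    show "mdist X (?g y) (?g y') = mdist Y y y'"
      using f(1) inv[OF y(1)] inv[OF y(2)] unfolding isometric_embedding_def by metis
  qed (use inv in auto)
  moreover have "?g ` mspace Y = mspace X"
    using isometric_embedding_inj[OF f(1)] f(2) by (metis inv_into_image_cancel subset_refl)
  ultimately show ?thesis unfolding isometric_def by blast
qed

lemma isometric_trans:
  assumes "isometric X Y" "isometric Y Z" shows "isometric X Z"
proof -
  obtain f g where "isometric_embedding X Y f" "f ` mspace X = mspace Y"
    "isometric_embedding Y Z g" "g ` mspace Y = mspace Z"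
    using assms unfolding isometric_def by blast
  then have "isometric_embedding X Z (g \<circ> f) \<and> (g \<circ> f) ` mspace X = mspace Z"
    using isometric_embedding_comp[of X Y f Z g] by (metis image_comp)
  then show ?thesis unfolding isometric_def by blast
qed

lemma compact_metric_bounded:
  assumes "compact_metric X"
  obtains D where "0 < D" "\<And>x y. x \<in> mspace X \<Longrightarrow> y \<in> mspace X \<Longrightarrow> mdist X x y \<le> D"
proof -
  interpret Metric_space "mspace X" "mdist X" by simp
  have "compactin mtopology (mspace X)"
    using assms unfolding compact_metric_def mtopology_of_def compact_space_def by simp
  then have "mbounded (mspace X)" by (rule compactin_imp_mbounded)
  then show ?thesis using that unfolding mbounded_alt_pos by blast
qed


subsection \<open>Correspondences\<close>

definition gh_corr :: "'a metric \<Rightarrow> 'b metric \<Rightarrow> real \<Rightarrow> ('a \<times> 'b) set \<Rightarrow> bool" where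
  "gh_corr X Y \<delta> R \<longleftrightarrow> R \<subseteq> mspace X \<times> mspace Y \<and> fst ` R = mspace X \<and> snd ` R = mspace Y \<and>
     (\<forall>(x,y)\<in>R. \<forall>(x',y')\<in>R. \<bar>mdist X x x' - mdist Y y y'\<bar> \<le> \<delta>)"

lemma gh_corr_D:
  assumes "gh_corr X Y \<delta> R" "(x,y) \<in> R" "(x',y') \<in> R"
  shows "\<bar>mdist X x x' - mdist Y y y'\<bar> \<le> \<delta>"
proof -
  have "\<forall>p\<in>R. \<forall>q\<in>R. \<bar>mdist X (fst p) (fst q) - mdist Y (snd p) (snd q)\<bar> \<le> \<delta>"
    using assms(1) unfolding gh_corr_def case_prod_beta by (elim conjE)
  from this[rule_format, OF assms(2,3)] show ?thesis by simp
qed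

lemma gh_corr_mem:
  assumes "gh_corr X Y \<delta> R" "(x,y) \<in> R"
  shows "x \<in> mspace X" "y \<in> mspace Y"
  using assms unfolding gh_corr_def by auto

lemma gh_corr_left:
  assumes "gh_corr X Y \<delta> R" "x \<in> mspace X"
  obtains y where "(x,y) \<in> R"
proof -
  have "x \<in> fst ` R" using assms unfolding gh_corr_def by simp
  then show ?thesis using that by (metis imageE prod.collapse)
qed

lemma gh_corr_right:
  assumes "gh_corr X Y \<delta> R" "y \<in> mspace Y"
  obtains x where "(x,y) \<in> R"
proof -
  have "y \<in> snd ` R" using assms unfolding gh_corr_def by simp
  then show ?thesis using that by (metis imageE prod.collapse)
qed

lemma gh_corrI:
  assumes "R \<subseteq> mspace X \<times> mspace Y"
    and "\<And>x. x \<in> mspace X \<Longrightarrow> \<exists>y. (x,y) \<in> R" "\<And>y. y \<in> mspace Y \<Longrightarrow> \<exists>x. (x,y) \<in> R"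
    and "\<And>x y x' y'. (x,y) \<in> R \<Longrightarrow> (x',y') \<in> R \<Longrightarrow> \<bar>mdist X x x' - mdist Y y y'\<bar> \<le> \<delta>"
  shows "gh_corr X Y \<delta> R"
proof -
  have "fst ` R = mspace X" "snd ` R = mspace Y"
    using assms(1-3) by (force simp: image_iff)+
  then show ?thesis
    using assms(1,4) unfolding gh_corr_def by (intro conjI) auto
qed

lemma gh_corr_converse:
  assumes "gh_corr X Y \<delta> R" shows "gh_corr Y X \<delta> (R\<inverse>)"
proof (rule gh_corrI)
  show "R\<inverse> \<subseteq> mspace Y \<times> mspace X" using gh_corr_mem[OF assms] by auto
  show "\<bar>mdist Y y y' - mdist X x x'\<bar> \<le> \<delta>" if "(y,x) \<in> R\<inverse>" "(y',x') \<in> R\<inverse>" for x y x' y'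
    using gh_corr_D[OF assms] that by (metis abs_minus_commute converse_iff)
qed (use gh_corr_left[OF assms] gh_corr_right[OF assms] in blast)+

lemma gh_corr_comp:
  assumes R: "gh_corr X Y \<delta> R" and T: "gh_corr Y Z \<epsilon> T"
  shows "gh_corr X Z (\<delta> + \<epsilon>) (R O T)"
proof (rule gh_corrI)
  show "R O T \<subseteq> mspace X \<times> mspace Z" using gh_corr_mem[OF R] gh_corr_mem[OF T] by auto
  show "\<exists>z. (x,z) \<in> R O T" if "x \<in> mspace X" for x
    using gh_corr_left[OF R that] gh_corr_left[OF T] gh_corr_mem[OF R] by (meson relcompI)
  show "\<exists>x. (x,z) \<in> R O T" if "z \<in> mspace Z" for z
    using gh_corr_right[OF T that] gh_corr_right[OF R] gh_corr_mem[OF T] by (meson relcompI)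
  show "\<bar>mdist X x x' - mdist Z z z'\<bar> \<le> \<delta> + \<epsilon>" if "(x,z) \<in> R O T" "(x',z') \<in> R O T" for x z x' z'
  proof -
    from that obtain y y' where "(x,y) \<in> R" "(y,z) \<in> T" "(x',y') \<in> R" "(y',z') \<in> T"
      by blast
    then show ?thesis
      using gh_corr_D[OF R, of x y x' y'] gh_corr_D[OF T, of y z y' z'] by linarith
  qed
qed

lemma push_metric:
  assumes M: "Metric_space M d" and e: "inj_on e M"
  obtains Z where "mspace Z = e ` M" "\<And>u v. u \<in> M \<Longrightarrow> v \<in> M \<Longrightarrow> mdist Z (e u) (e v) = d u v"
proof -
  interpret Metric_space M d by fact
  let ?i = "inv_into M e"
  let ?d = "\<lambda>a b. d (?i a) (?i b)"
  have N: "Metric_space (e ` M) ?d"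
  proof
    show "?d x y = 0 \<longleftrightarrow> x = y" if "x \<in> e ` M" "y \<in> e ` M" for x y
      using that by (metis f_inv_into_f inv_into_into zero)
    show "?d x z \<le> ?d x y + ?d y z" if "x \<in> e ` M" "y \<in> e ` M" "z \<in> e ` M" for x y z
      using that by (intro triangle) (auto simp: inv_into_into)
  qed (auto simp: commute)
  interpret N: Metric_space "e ` M" ?d by fact
  show ?thesis
    by (rule that[of "metric (e ` M, ?d)"]) (use e in auto)
qed

lemma Metric_space_sum:
  assumes X: "Metric_space A d" and Y: "Metric_space B d'"
    and pos: "\<And>x y. x \<in> A \<Longrightarrow> y \<in> B \<Longrightarrow> 0 < c x y"
    and t1: "\<And>x x' y. x \<in> A \<Longrightarrow> x' \<in> A \<Longrightarrow> y \<in> B \<Longrightarrow> c x y \<le> d x x' + c x' y"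
    and t2: "\<And>x y y'. x \<in> A \<Longrightarrow> y \<in> B \<Longrightarrow> y' \<in> B \<Longrightarrow> c x y \<le> c x y' + d' y' y"
    and t3: "\<And>x x' y. x \<in> A \<Longrightarrow> x' \<in> A \<Longrightarrow> y \<in> B \<Longrightarrow> d x x' \<le> c x y + c x' y"
    and t4: "\<And>x y y'. x \<in> A \<Longrightarrow> y \<in> B \<Longrightarrow> y' \<in> B \<Longrightarrow> d' y y' \<le> c x y + c x y'"
  shows "Metric_space (A <+> B) (\<lambda>u v. case u of
     Inl x \<Rightarrow> (case v of Inl x' \<Rightarrow> d x x' | Inr y \<Rightarrow> \<bar>c x y\<bar>)
   | Inr y \<Rightarrow> (case v of Inl x \<Rightarrow> \<bar>c x y\<bar> | Inr y' \<Rightarrow> d' y y'))"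
proof -
  interpret X: Metric_space A d by fact
  interpret Y: Metric_space B d' by fact
  have absc: "\<bar>c x y\<bar> = c x y" if "x \<in> A" "y \<in> B" for x y using pos[OF that] by simp
  have nz: "c x y \<noteq> 0" if "x \<in> A" "y \<in> B" for x y using pos[OF that] by simp
  show ?thesis
  proof
    fix u v w assume uvw: "u \<in> A <+> B" "v \<in> A <+> B" "w \<in> A <+> B"
    show "(case u of
     Inl x \<Rightarrow> (case w of Inl x' \<Rightarrow> d x x' | Inr y \<Rightarrow> \<bar>c x y\<bar>)
   | Inr y \<Rightarrow> (case w of Inl x \<Rightarrow> \<bar>c x y\<bar> | Inr y' \<Rightarrow> d' y y'))
     \<le> (case u of
     Inl x \<Rightarrow> (case v of Inl x' \<Rightarrow> d x x' | Inr y \<Rightarrow> \<bar>c x y\<bar>)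
   | Inr y \<Rightarrow> (case v of Inl x \<Rightarrow> \<bar>c x y\<bar> | Inr y' \<Rightarrow> d' y y'))
     + (case v of
     Inl x \<Rightarrow> (case w of Inl x' \<Rightarrow> d x x' | Inr y \<Rightarrow> \<bar>c x y\<bar>)
   | Inr y \<Rightarrow> (case w of Inl x \<Rightarrow> \<bar>c x y\<bar> | Inr y' \<Rightarrow> d' y y'))"
      using uvw
      apply (elim PlusE; simp add: absc X.triangle Y.triangle t1 t2 t3 t4)
       apply (metis X.commute add.commute t1)
      apply (metis Y.commute add.commute t2)
      done
  qed (auto split: sum.splits simp: X.commute Y.commute nz)
qed

lemma inj_sum_real: "inj (case_sum exp (\<lambda>y. - exp y) :: real + real \<Rightarrow> real)"
proof (rule injI)
  have "exp x \<noteq> - exp y" "- exp y \<noteq> exp x" for x y :: real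
    using exp_gt_zero[of x] exp_gt_zero[of y] by linarith+
  then show "u = v" if "case_sum exp (\<lambda>y. - exp y) u = (case_sum exp (\<lambda>y. - exp y) v :: real)"
    for u v :: "real + real"
    using that by (auto split: sum.splits)
qed

lemma gh_corr_ambient:
  fixes X Y :: "real metric"
  assumes R: "gh_corr X Y (2 * r) R" and r: "0 < r"
  obtains Z :: "real metric" and f g where "isometric_embedding X Z f" "isometric_embedding Y Z g"
    "hausdorff_dist Z (f ` mspace X) (g ` mspace Y) \<le> r"
proof -
  interpret X: Metric_space "mspace X" "mdist X" by simp
  interpret Y: Metric_space "mspace Y" "mdist Y" by simp
  define p where "p = (\<lambda>x y (a,b). mdist X x a + r + mdist Y b y)"
  define c where "c = (\<lambda>x y. INF q\<in>R. p x y q)"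
  have ple: "r \<le> p x y q" for x y q
    unfolding p_def by (auto simp: case_prod_beta)
  have bdd: "bdd_below (p x y ` R)" for x y
    using ple by (auto intro!: bdd_belowI[of _ r])
  have cle: "c x y \<le> p x y q" if "q \<in> R" for x y q
    unfolding c_def using that by (intro cINF_lower bdd)
  have ne: "R \<noteq> {}" if "x \<in> mspace X" for x
    using gh_corr_left[OF R that] by blast
  have cge: "m \<le> c x y" if "R \<noteq> {}" "\<And>q. q \<in> R \<Longrightarrow> m \<le> p x y q" for m x y
    unfolding c_def using that by (intro cINF_greatest)
  have pos: "0 < c x y" if "x \<in> mspace X" for x y
    using cge[OF ne[OF that], of r x y] ple r by fastforce
  have t1: "c x y \<le> mdist X x x' + c x' y" if "x \<in> mspace X" "x' \<in> mspace X" for x x' y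
  proof -
    have "c x y - mdist X x x' \<le> c x' y"
    proof (rule cge[OF ne[OF that(1)]])
      fix q assume q: "q \<in> R"
      obtain a b where ab: "q = (a,b)" by (cases q)
      have "mdist X x a \<le> mdist X x x' + mdist X x' a"
        using that q ab gh_corr_mem[OF R] by (intro X.triangle) auto
      then show "c x y - mdist X x x' \<le> p x' y q"
        using cle[OF q, of x y] unfolding p_def ab by simp
    qed
    then show ?thesis by simp
  qed
  have t2: "c x y \<le> c x y' + mdist Y y' y"
    if "x \<in> mspace X" "y \<in> mspace Y" "y' \<in> mspace Y" for x y y'
  proof -
    have "c x y - mdist Y y' y \<le> c x y'"
    proof (rule cge[OF ne[OF that(1)]])
      fix q assume q: "q \<in> R"
      obtain a b where ab: "q = (a,b)" by (cases q)
      have "mdist Y b y \<le> mdist Y b y' + mdist Y y' y"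
        using that q ab gh_corr_mem[OF R] by (intro Y.triangle) auto
      then show "c x y - mdist Y y' y \<le> p x y' q"
        using cle[OF q, of x y] unfolding p_def ab by simp
    qed
    then show ?thesis by simp
  qed
  have t3: "mdist X x x' \<le> c x y + c x' y"
    if "x \<in> mspace X" "x' \<in> mspace X" "y \<in> mspace Y" for x x' y
  proof -
    have "mdist X x x' - c x' y \<le> c x y"
    proof (rule cge[OF ne[OF that(1)]])
      fix q assume q: "q \<in> R"
      obtain a b where ab: "q = (a,b)" by (cases q)
      have "mdist X x x' - p x y q \<le> c x' y"
      proof (rule cge[OF ne[OF that(1)]])
        fix q' assume q': "q' \<in> R"
        obtain a' b' where ab': "q' = (a',b')" by (cases q')
        have m: "a \<in> mspace X" "a' \<in> mspace X" "b \<in> mspace Y" "b' \<in> mspace Y"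
          using q q' ab ab' gh_corr_mem[OF R] by auto
        have "mdist X x x' \<le> mdist X x a + mdist X a x'"
          "mdist X a x' \<le> mdist X a a' + mdist X a' x'"
          "mdist Y b b' \<le> mdist Y b y + mdist Y y b'"
          using that m by (auto intro: X.triangle Y.triangle)
        moreover have "mdist X a a' \<le> 2 * r + mdist Y b b'"
          using gh_corr_D[OF R, of a b a' b'] q q' ab ab' by auto
        ultimately show "mdist X x x' - p x y q \<le> p x' y q'"
          unfolding p_def ab ab' using X.commute[of x' a'] Y.commute[of y b'] by simp
      qed
      then show "mdist X x x' - c x' y \<le> p x y q" by simp
    qed
    then show ?thesis by simp
  qed
  have t4: "mdist Y y y' \<le> c x y + c x y'"
    if "x \<in> mspace X" "y \<in> mspace Y" "y' \<in> mspace Y" for x y y'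
  proof -
    have "mdist Y y y' - c x y' \<le> c x y"
    proof (rule cge[OF ne[OF that(1)]])
      fix q assume q: "q \<in> R"
      obtain a b where ab: "q = (a,b)" by (cases q)
      have "mdist Y y y' - p x y q \<le> c x y'"
      proof (rule cge[OF ne[OF that(1)]])
        fix q' assume q': "q' \<in> R"
        obtain a' b' where ab': "q' = (a',b')" by (cases q')
        have m: "a \<in> mspace X" "a' \<in> mspace X" "b \<in> mspace Y" "b' \<in> mspace Y"
          using q q' ab ab' gh_corr_mem[OF R] by auto
        have "mdist Y y y' \<le> mdist Y y b + mdist Y b y'"
          "mdist Y b y' \<le> mdist Y b b' + mdist Y b' y'"
          "mdist X a a' \<le> mdist X a x + mdist X x a'"
          using that m by (auto intro: X.triangle Y.triangle)
        moreover have "mdist Y b b' \<le> 2 * r + mdist X a a'"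
          using gh_corr_D[OF R, of a b a' b'] q q' ab ab' by auto
        ultimately show "mdist Y y y' - p x y q \<le> p x y' q'"
          unfolding p_def ab ab' using X.commute[of x a] Y.commute[of y b] by simp
      qed
      then show "mdist Y y y' - c x y' \<le> p x y q" by simp
    qed
    then show ?thesis by simp
  qed
  have cR: "c a b \<le> r" if "(a,b) \<in> R" for a b
    using cle[OF that, of a b] gh_corr_mem[OF R that] unfolding p_def by simp
  define d where "d = (\<lambda>u v. case u of
     Inl x \<Rightarrow> (case v of Inl x' \<Rightarrow> mdist X x x' | Inr y \<Rightarrow> \<bar>c x y\<bar>)
   | Inr y \<Rightarrow> (case v of Inl x \<Rightarrow> \<bar>c x y\<bar> | Inr y' \<Rightarrow> mdist Y y y'))"
  have "Metric_space (mspace X <+> mspace Y) d"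
    unfolding d_def by (rule Metric_space_sum) (use pos t1 t2 t3 t4 in auto)
  then obtain Z :: "real metric" where
    Z: "mspace Z = case_sum exp (\<lambda>y. - exp y) ` (mspace X <+> mspace Y)" and
    dZ: "\<And>u v. u \<in> mspace X <+> mspace Y \<Longrightarrow> v \<in> mspace X <+> mspace Y \<Longrightarrow>
       mdist Z (case_sum exp (\<lambda>y. - exp y) u) (case_sum exp (\<lambda>y. - exp y) v) = d u v"
    using push_metric[OF _ inj_on_subset[OF inj_sum_real subset_UNIV]] by blast
  have dZ12: "mdist Z (exp x) (- exp y) = c x y" if "x \<in> mspace X" "y \<in> mspace Y" for x y
    using dZ[of "Inl x" "Inr y"] that pos[OF that(1), of y] by (auto simp: d_def)
  show ?thesis
  proof
    show "isometric_embedding X Z exp"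
      unfolding isometric_embedding_def
    proof (intro conjI ballI)
      show "exp \<in> mspace X \<rightarrow> mspace Z" unfolding Z by (force simp: image_iff)
      show "mdist Z (exp x) (exp x') = mdist X x x'" if "x \<in> mspace X" "x' \<in> mspace X" for x x'
        using dZ[of "Inl x" "Inl x'"] that by (auto simp: d_def)
    qed
    show "isometric_embedding Y Z (\<lambda>y. - exp y)"
      unfolding isometric_embedding_def
    proof (intro conjI ballI)
      show "(\<lambda>y. - exp y) \<in> mspace Y \<rightarrow> mspace Z" unfolding Z by (force simp: image_iff)
      show "mdist Z (- exp x) (- exp x') = mdist Y x x'" if "x \<in> mspace Y" "x' \<in> mspace Y" for x x'
        using dZ[of "Inr x" "Inr x'"] that by (auto simp: d_def)
    qed
    have "\<exists>y\<in>mspace Y. mdist Z (exp x) (- exp y) \<le> r" if "x \<in> mspace X" for x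
      using gh_corr_left[OF R that] gh_corr_mem[OF R] cR dZ12 by metis
    moreover have "\<exists>x\<in>mspace X. mdist Z (exp x) (- exp y) \<le> r" if "y \<in> mspace Y" for y
      using gh_corr_right[OF R that] gh_corr_mem[OF R] cR dZ12 by metis
    ultimately show "hausdorff_dist Z (exp ` mspace X) ((\<lambda>y. - exp y) ` mspace Y) \<le> r"
      unfolding hausdorff_dist_def using r by (intro cInf_lower bdd_belowI[of _ 0]) auto
  qed
qed

lemma hausdorff_set_nonempty:
  assumes X: "compact_metric X" and Y: "compact_metric Y"
    and f: "isometric_embedding X Z f" and g: "isometric_embedding Y Z g"
  shows "{r. 0 \<le> r \<and> (\<forall>a\<in>f ` mspace X. \<exists>b\<in>g ` mspace Y. mdist Z a b \<le> r) \<and>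
     (\<forall>b\<in>g ` mspace Y. \<exists>a\<in>f ` mspace X. mdist Z a b \<le> r)} \<noteq> {}"
proof -
  obtain D where D: "0 < D" "\<And>x y. x \<in> mspace X \<Longrightarrow> y \<in> mspace X \<Longrightarrow> mdist X x y \<le> D"
    using compact_metric_bounded[OF X] by metis
  obtain D' where D': "0 < D'" "\<And>x y. x \<in> mspace Y \<Longrightarrow> y \<in> mspace Y \<Longrightarrow> mdist Y x y \<le> D'"
    using compact_metric_bounded[OF Y] by metis
  obtain x0 y0 where 0: "x0 \<in> mspace X" "y0 \<in> mspace Y"
    using X Y unfolding compact_metric_def by blast
  let ?r = "D + mdist Z (f x0) (g y0) + D'"
  have fm: "f x \<in> mspace Z" "mdist Z (f x) (f x0) \<le> D" if "x \<in> mspace X" for x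
    using that f 0 D unfolding isometric_embedding_def by (auto simp: Pi_iff)
  have gm: "g y \<in> mspace Z" "mdist Z (g y0) (g y) \<le> D'" if "y \<in> mspace Y" for y
    using that g 0 D' unfolding isometric_embedding_def by (auto simp: Pi_iff)
  have "mdist Z (f x) (g y) \<le> ?r" if "x \<in> mspace X" "y \<in> mspace Y" for x y
    using mdist_triangle[of "f x" Z "f x0" "g y"] mdist_triangle[of "f x0" Z "g y0" "g y"]
      fm[OF that(1)] gm[OF that(2)] fm[OF 0(1)] gm[OF 0(2)] by linarith
  then have "?r \<in> {r. 0 \<le> r \<and> (\<forall>a\<in>f ` mspace X. \<exists>b\<in>g ` mspace Y. mdist Z a b \<le> r) \<and>
     (\<forall>b\<in>g ` mspace Y. \<exists>a\<in>f ` mspace X. mdist Z a b \<le> r)}"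
    using 0 D(1) D'(1) mdist_nonneg[of Z "f x0" "g y0"] by auto
  then show ?thesis by blast
qed

lemma hausdorff_dist_nonneg:
  assumes "compact_metric X" "compact_metric Y" "isometric_embedding X Z f" "isometric_embedding Y Z g"
  shows "0 \<le> hausdorff_dist Z (f ` mspace X) (g ` mspace Y)"
  unfolding hausdorff_dist_def
  by (rule cInf_greatest[OF hausdorff_set_nonempty[OF assms]]) simp

lemma gh_corr_full:
  assumes X: "compact_metric X" and Y: "compact_metric Y"
  obtains r where "0 < r" "gh_corr X Y (2 * r) (mspace X \<times> mspace Y)"
proof -
  obtain D where D: "0 < D" "\<And>x y. x \<in> mspace X \<Longrightarrow> y \<in> mspace X \<Longrightarrow> mdist X x y \<le> D"
    using compact_metric_bounded[OF X] by metis
  obtain D' where D': "0 < D'" "\<And>x y. x \<in> mspace Y \<Longrightarrow> y \<in> mspace Y \<Longrightarrow> mdist Y x y \<le> D'"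
    using compact_metric_bounded[OF Y] by metis
  have "gh_corr X Y (2 * (D + D')) (mspace X \<times> mspace Y)"
  proof (rule gh_corrI)
    show "\<bar>mdist X x x' - mdist Y y y'\<bar> \<le> 2 * (D + D')"
      if "(x,y) \<in> mspace X \<times> mspace Y" "(x',y') \<in> mspace X \<times> mspace Y" for x y x' y'
    proof -
      have "mdist X x x' \<le> D" "mdist Y y y' \<le> D'" using that D(2) D'(2) by auto
      moreover have "\<bar>a - b\<bar> \<le> 2 * (D + D')" if "0 \<le> a" "a \<le> D" "0 \<le> b" "b \<le> D'" for a b
        using that by (simp add: abs_le_iff)
      ultimately show ?thesis by simp
    qed
  qed (use X Y in \<open>auto simp: compact_metric_def\<close>)
  then show ?thesis using that[of "D + D'"] D(1) D'(1) by simp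
qed

lemma gh_set_nonempty:
  fixes X Y :: "real metric"
  assumes X: "compact_metric X" and Y: "compact_metric Y"
  shows "{hausdorff_dist Z (f ` mspace X) (g ` mspace Y) | (Z :: real metric) f g.
     isometric_embedding X Z f \<and> isometric_embedding Y Z g} \<noteq> {}"
proof -
  obtain r where r: "0 < r" "gh_corr X Y (2 * r) (mspace X \<times> mspace Y)"
    using gh_corr_full[OF X Y] by metis
  obtain Z :: "real metric" and f g where "isometric_embedding X Z f" "isometric_embedding Y Z g"
    by (rule gh_corr_ambient[OF r(2,1)])
  then have "hausdorff_dist Z (f ` mspace X) (g ` mspace Y) \<in>
    {hausdorff_dist Z (f ` mspace X) (g ` mspace Y) | (Z :: real metric) f g.
     isometric_embedding X Z f \<and> isometric_embedding Y Z g}"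
    by (intro CollectI exI conjI) (rule refl | assumption)+
  then show ?thesis by (metis empty_iff)
qed

lemma gh_dist_le:
  fixes Z :: "real metric"
  assumes "compact_metric X" "compact_metric Y" "isometric_embedding X Z f" "isometric_embedding Y Z g"
  shows "gh_dist X Y \<le> hausdorff_dist Z (f ` mspace X) (g ` mspace Y)"
  unfolding gh_dist_def
proof (rule cInf_lower)
  show "bdd_below {hausdorff_dist Z (f ` mspace X) (g ` mspace Y) | (Z :: real metric) f g.
     isometric_embedding X Z f \<and> isometric_embedding Y Z g}"
    by (rule bdd_belowI[of _ 0]) (auto intro: hausdorff_dist_nonneg[OF assms(1,2)])
  show "hausdorff_dist Z (f ` mspace X) (g ` mspace Y) \<in>
    {hausdorff_dist Z (f ` mspace X) (g ` mspace Y) | (Z :: real metric) f g.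
     isometric_embedding X Z f \<and> isometric_embedding Y Z g}"
    using assms(3,4) by (intro CollectI exI conjI) (rule refl | assumption)+
qed

lemma gh_dist_nonneg:
  assumes "compact_metric X" "compact_metric Y"
  shows "0 \<le> gh_dist X Y"
  unfolding gh_dist_def
proof (rule cInf_greatest[OF gh_set_nonempty[OF assms]])
  fix t assume "t \<in> {hausdorff_dist Z (f ` mspace X) (g ` mspace Y) | (Z :: real metric) f g.
     isometric_embedding X Z f \<and> isometric_embedding Y Z g}"
  then show "0 \<le> t" by (auto intro: hausdorff_dist_nonneg[OF assms])
qed

lemma gh_dist_le_corr:
  assumes "compact_metric X" "compact_metric Y" "gh_corr X Y (2 * r) R" "0 < r"
  shows "gh_dist X Y \<le> r"
proof (rule gh_corr_ambient[OF assms(3,4)])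
  fix Z :: "real metric" and f g
  assume "isometric_embedding X Z f" "isometric_embedding Y Z g"
    "hausdorff_dist Z (f ` mspace X) (g ` mspace Y) \<le> r"
  then show ?thesis using gh_dist_le[OF assms(1,2), of Z f g] by linarith
qed

lemma gh_dist_less_corr:
  assumes X: "compact_metric X" and Y: "compact_metric Y" and r: "gh_dist X Y < r"
  obtains R where "gh_corr X Y (2 * r) R"
proof -
  obtain Z :: "real metric" and f g where f: "isometric_embedding X Z f"
    and g: "isometric_embedding Y Z g"
    and lt: "hausdorff_dist Z (f ` mspace X) (g ` mspace Y) < r"
    using cInf_lessD[OF gh_set_nonempty[OF X Y] r[unfolded gh_dist_def]]
    by (elim bexE CollectE exE conjE) simp
  obtain t where t: "t < r" "\<forall>a\<in>f ` mspace X. \<exists>b\<in>g ` mspace Y. mdist Z a b \<le> t"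
     "\<forall>b\<in>g ` mspace Y. \<exists>a\<in>f ` mspace X. mdist Z a b \<le> t"
    using cInf_lessD[OF hausdorff_set_nonempty[OF X Y f g] lt[unfolded hausdorff_dist_def]]
    by (elim bexE CollectE conjE) simp
  let ?R = "{(x,y). x \<in> mspace X \<and> y \<in> mspace Y \<and> mdist Z (f x) (g y) \<le> t}"
  have "gh_corr X Y (2 * r) ?R"
  proof (rule gh_corrI)
    fix x y x' y' assume "(x,y) \<in> ?R" "(x',y') \<in> ?R"
    then have m: "x \<in> mspace X" "y \<in> mspace Y" "x' \<in> mspace X" "y' \<in> mspace Y"
      and le: "mdist Z (f x) (g y) \<le> t" "mdist Z (f x') (g y') \<le> t" by auto
    have mz: "f x \<in> mspace Z" "f x' \<in> mspace Z" "g y \<in> mspace Z" "g y' \<in> mspace Z"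
      and eq: "mdist Z (f x) (f x') = mdist X x x'" "mdist Z (g y) (g y') = mdist Y y y'"
      using m f g unfolding isometric_embedding_def by auto
    have "mdist Z (f x) (f x') \<le> mdist Z (f x) (g y) + mdist Z (g y) (f x')"
      "mdist Z (g y) (f x') \<le> mdist Z (g y) (g y') + mdist Z (g y') (f x')"
      "mdist Z (g y) (g y') \<le> mdist Z (g y) (f x) + mdist Z (f x) (g y')"
      "mdist Z (f x) (g y') \<le> mdist Z (f x) (f x') + mdist Z (f x') (g y')"
      using mz by (auto intro: mdist_triangle)
    then show "\<bar>mdist X x x' - mdist Y y y'\<bar> \<le> 2 * r"
      using le t(1) eq mdist_commute[of Z "g y'" "f x'"] mdist_commute[of Z "g y" "f x"] by linarith
  qed (use t in auto)
  then show ?thesis by (rule that)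
qed


subsection \<open>Spaces at distance zero\<close>

lemma gh_embedding_of_corr:
  assumes X: "compact_metric X" and Y: "compact_metric Y"
    and R: "\<And>r. 0 < r \<Longrightarrow> \<exists>R. gh_corr X Y r R"
  shows "\<exists>f. isometric_embedding X Y f"
proof -
  let ?P = "product_topology (\<lambda>_. mtopology_of Y) (mspace X)"
  define B where "B = (\<lambda>n x x'. {f \<in> topspace ?P. mdist Y (f x) (f x') \<in>
     {mdist X x x' - inverse (real (Suc n)) .. mdist X x x' + inverse (real (Suc n))}})"
  define C where "C = (\<lambda>n. \<Inter>x\<in>mspace X. \<Inter>x'\<in>mspace X. B n x x')"
  have neX: "mspace X \<noteq> {}" using X unfolding compact_metric_def by blast
  have cl: "closedin ?P (B n x x')" if "x \<in> mspace X" "x' \<in> mspace X" for n x x'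
    unfolding B_def
    by (rule closedin_continuous_map_preimage[where Y = euclidean])
      (use that in \<open>auto intro!: continuous_map_mdist continuous_map_product_projection\<close>)
  have "(\<Inter>n. C n) \<noteq> {}"
  proof (rule compact_space_imp_nest[of ?P])
    show "compact_space ?P"
      using Y unfolding compact_space_product_topology compact_metric_def by simp
    show "closedin ?P (C n)" for n
      unfolding C_def using neX cl by (intro closedin_INT) auto
    show "C n \<noteq> {}" for n
    proof -
      obtain R where R: "gh_corr X Y (inverse (real (Suc n))) R" using R by fastforce
      have "\<forall>x\<in>mspace X. \<exists>y. (x, y) \<in> R"
        using gh_corr_left[OF R] by blast
      then obtain h where h: "\<And>x. x \<in> mspace X \<Longrightarrow> (x, h x) \<in> R"
        by metis
      have "restrict h (mspace X) \<in> B n x x'" if "x \<in> mspace X" "x' \<in> mspace X" for x x'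
        using gh_corr_D[OF R h h, OF that] gh_corr_mem(2)[OF R h] that
        unfolding B_def by (auto simp: abs_le_iff)
      then show ?thesis unfolding C_def by blast
    qed
    have mono: "B n x x' \<subseteq> B m x x'" if "m \<le> n" for m n x x'
    proof -
      have le: "inverse (real (Suc n)) \<le> inverse (real (Suc m))"
        using that by (intro le_imp_inverse_le) auto
      show ?thesis
      proof
        fix f assume "f \<in> B n x x'"
        then show "f \<in> B m x x'"
          unfolding B_def mem_Collect_eq atLeastAtMost_iff
          by (elim conjE, intro conjI) (assumption | use le in linarith)+
      qed
    qed
    show "decseq C"
      unfolding decseq_def
    proof (intro allI impI subsetI)
      fix m n f assume "m \<le> n" "f \<in> C n"
      then show "f \<in> C m"
        using mono[OF \<open>m \<le> n\<close>] unfolding C_def INT_iff by (meson subsetD)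
    qed
  qed
  then obtain f where f0: "f \<in> (\<Inter>n. C n)" by (metis ex_in_conv)
  have f: "f \<in> B n x x'" if "x \<in> mspace X" "x' \<in> mspace X" for n x x'
    using f0 that unfolding C_def INT_iff by simp
  have "isometric_embedding X Y f"
    unfolding isometric_embedding_def
  proof (intro conjI ballI)
    show "f \<in> mspace X \<rightarrow> mspace Y"
      using f neX unfolding B_def by (fastforce simp: PiE_iff)
    fix x x' assume x: "x \<in> mspace X" "x' \<in> mspace X"
    have le: "\<bar>mdist Y (f x) (f x') - mdist X x x'\<bar> \<le> inverse (real (Suc n))" for n
      using f[OF x, of n] unfolding B_def by (auto simp: abs_le_iff)
    show "mdist Y (f x) (f x') = mdist X x x'"
    proof (rule ccontr)
      assume "\<not> ?thesis"
      then obtain n where "inverse (real (Suc n)) < \<bar>mdist Y (f x) (f x') - mdist X x x'\<bar>"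
        using reals_Archimedean[of "\<bar>mdist Y (f x) (f x') - mdist X x x'\<bar>"] by auto
      then show False using le[of n] by linarith
    qed
  qed
  then show ?thesis by blast
qed

lemma self_embedding_surj:
  assumes X: "compact_metric X" and h: "isometric_embedding X X h"
  shows "h ` mspace X = mspace X"
proof (rule ccontr)
  assume "h ` mspace X \<noteq> mspace X"
  moreover have hX: "h x \<in> mspace X" if "x \<in> mspace X" for x
    using h that unfolding isometric_embedding_def by auto
  ultimately obtain p where p: "p \<in> mspace X" "p \<notin> h ` mspace X" by blast
  interpret Metric_space "mspace X" "mdist X" by simp
  have comp: "compact_space mtopology"
    using X unfolding compact_metric_def mtopology_of_def by simp
  have hd: "mdist X (h x) (h y) = mdist X x y" if "x \<in> mspace X" "y \<in> mspace X" for x y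
    using h that unfolding isometric_embedding_def by auto
  have itX: "(h ^^ n) x \<in> mspace X" if "x \<in> mspace X" for n x
    by (induction n) (use that hX in auto)
  have itd: "mdist X ((h ^^ n) x) ((h ^^ n) y) = mdist X x y" if "x \<in> mspace X" "y \<in> mspace X" for n x y
    by (induction n) (use that hd itX in auto)
  have conv: "\<exists>l r. l \<in> mspace X \<and> strict_mono r \<and> limitin mtopology (\<sigma> \<circ> r) l sequentially"
    if "range \<sigma> \<subseteq> mspace X" for \<sigma> :: "nat \<Rightarrow> 'a"
    using comp that unfolding compact_space_sequentially by blast
  have close: "\<exists>m>0. mdist X p ((h ^^ m) p) < e" if "0 < e" for e
  proof -
    obtain l r where l: "l \<in> mspace X" and r: "strict_mono r"
      and lim: "limitin mtopology ((\<lambda>n. (h ^^ n) p) \<circ> r) l sequentially"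
      using conv[of "\<lambda>n. (h ^^ n) p"] itX[OF p(1)] by blast
    have "\<exists>N. \<forall>n\<ge>N. ((\<lambda>n. (h ^^ n) p) \<circ> r) n \<in> mspace X \<and>
        mdist X (((\<lambda>n. (h ^^ n) p) \<circ> r) n) l < e / 2"
      using lim[unfolded limit_metric_sequentially] \<open>0 < e\<close> half_gt_zero by blast
    then obtain N where N: "\<And>n. n \<ge> N \<Longrightarrow> mdist X ((h ^^ (r n)) p) l < e / 2"
      by auto
    have lt: "r N < r (Suc N)" using r by (simp add: strict_mono_Suc_iff)
    define m where "m = r (Suc N) - r N"
    have m: "r (Suc N) = r N + m" "0 < m" using lt by (auto simp: m_def)
    have "mdist X p ((h ^^ m) p) = mdist X ((h ^^ r N) p) ((h ^^ r N) ((h ^^ m) p))"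
      using itd p(1) itX by metis
    also have "\<dots> = mdist X ((h ^^ r N) p) ((h ^^ r (Suc N)) p)"
      by (simp add: m(1) funpow_add)
    also have "\<dots> \<le> mdist X ((h ^^ r N) p) l + mdist X l ((h ^^ r (Suc N)) p)"
      using itX p(1) l by (intro triangle) auto
    also have "\<dots> < e"
      using N[of N] N[of "Suc N"] commute[of l "(h ^^ r (Suc N)) p"] by simp
    finally show ?thesis using m by blast
  qed
  have "\<exists>q\<in>mspace X. mdist X p (h q) < inverse (real (Suc n))" for n
  proof -
    obtain m where m: "m > 0" "mdist X p ((h ^^ m) p) < inverse (real (Suc n))"
      using close[of "inverse (real (Suc n))"] by auto
    then obtain k where "m = Suc k" by (cases m) auto
    then show ?thesis using m itX[OF p(1), of k] by auto
  qed
  then obtain q where q: "\<And>n. q n \<in> mspace X" "\<And>n. mdist X p (h (q n)) < inverse (real (Suc n))"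
    by metis
  obtain l r where l: "l \<in> mspace X" and r: "strict_mono r"
    and lim: "limitin mtopology (q \<circ> r) l sequentially"
    using conv[of q] q(1) by blast
  have "mdist X p (h l) < e" if "0 < e" for e
  proof -
    have "\<exists>N. \<forall>n\<ge>N. (q \<circ> r) n \<in> mspace X \<and> mdist X ((q \<circ> r) n) l < e / 2"
      using lim[unfolded limit_metric_sequentially] \<open>0 < e\<close> half_gt_zero by blast
    then obtain N where N: "\<And>n. n \<ge> N \<Longrightarrow> mdist X (q (r n)) l < e / 2"
      by auto
    obtain M where M: "inverse (real (Suc M)) < e / 2"
      using reals_Archimedean[of "e / 2"] \<open>0 < e\<close> by auto
    let ?n = "max N M"
    have "M \<le> r ?n" using seq_suble[OF r, of ?n] by linarith
    then have "inverse (real (Suc (r ?n))) \<le> inverse (real (Suc M))"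
      by (intro le_imp_inverse_le) auto
    moreover have "mdist X p (h l) \<le> mdist X p (h (q (r ?n))) + mdist X (h (q (r ?n))) (h l)"
      using p(1) hX q(1) l by (intro triangle) auto
    ultimately show ?thesis
      using q(2)[of "r ?n"] N[OF max.cobounded1, of M] M hd[OF q(1) l, of "r ?n"] by linarith
  qed
  then have "mdist X p (h l) = 0"
    using mdist_nonneg[of X p "h l"] by (metis less_irrefl linorder_not_less order_le_less)
  then show False using p l hX by auto
qed

lemma isometric_of_gh_dist_0:
  assumes X: "compact_metric X" and Y: "compact_metric Y" and 0: "gh_dist X Y = 0"
  shows "isometric X Y"
proof -
  have R: "\<exists>R. gh_corr X Y r R" if "0 < r" for r
    using gh_dist_less_corr[OF X Y, of "r / 2"] that 0 by auto
  obtain f where f: "isometric_embedding X Y f" using gh_embedding_of_corr[OF X Y R] by blast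
  have "\<exists>R. gh_corr Y X r R" if "0 < r" for r
    using R[OF that] gh_corr_converse by blast
  then obtain g where g: "isometric_embedding Y X g" using gh_embedding_of_corr[OF Y X] by blast
  have "(f \<circ> g) ` mspace Y = mspace Y"
    by (rule self_embedding_surj[OF Y isometric_embedding_comp[OF g f]])
  then have "f ` mspace X = mspace Y"
    using f g unfolding isometric_embedding_def by (auto simp: image_iff Pi_iff) (metis comp_apply imageE)
  then show ?thesis using f unfolding isometric_def by blast
qed

lemma gh_dist_0_of_isometric:
  assumes X: "compact_metric X" and Y: "compact_metric Y" and i: "isometric X Y"
  shows "gh_dist X Y = 0"
proof -
  obtain f where f: "isometric_embedding X Y f" "f ` mspace X = mspace Y"
    using i unfolding isometric_def by blast
  have corr: "gh_corr X Y (2 * r) ((\<lambda>x. (x, f x)) ` mspace X)" if "0 < r" for r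
  proof (rule gh_corrI)
    show "(\<lambda>x. (x, f x)) ` mspace X \<subseteq> mspace X \<times> mspace Y" using f(2) by blast
    show "\<exists>y. (x, y) \<in> (\<lambda>x. (x, f x)) ` mspace X" if "x \<in> mspace X" for x using that by blast
    show "\<exists>x. (x, y) \<in> (\<lambda>x. (x, f x)) ` mspace X" if "y \<in> mspace Y" for y
      using that unfolding f(2)[symmetric] by blast
    fix x y x' y'
    assume "(x,y) \<in> (\<lambda>x. (x, f x)) ` mspace X" "(x',y') \<in> (\<lambda>x. (x, f x)) ` mspace X"
    then have "mdist Y y y' = mdist X x x'"
      using f(1) unfolding isometric_embedding_def by auto
    then show "\<bar>mdist X x x' - mdist Y y y'\<bar> \<le> 2 * r" using \<open>0 < r\<close> by simp
  qed
  have "gh_dist X Y \<le> 0"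
  proof (rule field_le_epsilon)
    fix e :: real assume e: "0 < e"
    show "gh_dist X Y \<le> 0 + e" using gh_dist_le_corr[OF X Y corr[OF e] e] by simp
  qed
  then show ?thesis using gh_dist_nonneg[OF X Y] by simp
qed

lemma gh_dist_commute:
  assumes X: "compact_metric X" and Y: "compact_metric Y"
  shows "gh_dist X Y = gh_dist Y X"
proof -
  have "gh_dist Y X \<le> gh_dist X Y" if X: "compact_metric X" and Y: "compact_metric Y" for X Y
  proof (rule field_le_epsilon)
    fix e :: real assume e: "0 < e"
    obtain R where "gh_corr X Y (2 * (gh_dist X Y + e)) R"
      using gh_dist_less_corr[OF X Y, of "gh_dist X Y + e"] e by auto
    then show "gh_dist Y X \<le> gh_dist X Y + e"
      using gh_dist_le_corr[OF Y X gh_corr_converse] gh_dist_nonneg[OF X Y] e by fastforce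
  qed
  then show ?thesis using X Y by (simp add: order_antisym)
qed

lemma gh_dist_triangle:
  assumes X: "compact_metric X" and Y: "compact_metric Y" and Z: "compact_metric Z"
  shows "gh_dist X Z \<le> gh_dist X Y + gh_dist Y Z"
proof (rule field_le_epsilon)
  fix e :: real assume e: "0 < e"
  obtain R where R: "gh_corr X Y (2 * (gh_dist X Y + e / 2)) R"
    using gh_dist_less_corr[OF X Y, of "gh_dist X Y + e / 2"] e by auto
  obtain T where T: "gh_corr Y Z (2 * (gh_dist Y Z + e / 2)) T"
    using gh_dist_less_corr[OF Y Z, of "gh_dist Y Z + e / 2"] e by auto
  have "gh_corr X Z (2 * (gh_dist X Y + gh_dist Y Z + e)) (R O T)"
    using gh_corr_comp[OF R T] by (simp add: algebra_simps)
  then show "gh_dist X Z \<le> gh_dist X Y + gh_dist Y Z + e"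
    using gh_dist_le_corr[OF X Z] gh_dist_nonneg[OF X Y] gh_dist_nonneg[OF Y Z] e by fastforce
qed

lemma gh_dist_cong:
  assumes "gh_rel X X'" "gh_rel Y Y'"
  shows "gh_dist X Y = gh_dist X' Y'"
proof -
  have le: "gh_dist X Y \<le> gh_dist X' Y'" if "gh_rel X X'" "gh_rel Y Y'" for X X' Y Y'
  proof -
    have c: "compact_metric X" "compact_metric X'" "compact_metric Y" "compact_metric Y'"
      using that unfolding gh_rel_def by auto
    have "gh_dist X X' = 0" "gh_dist Y' Y = 0"
      using that c gh_dist_0_of_isometric isometric_sym unfolding gh_rel_def by blast+
    then show ?thesis
      using gh_dist_triangle[OF c(1,2,3)] gh_dist_triangle[OF c(2,4,3)] by linarith
  qed
  have "gh_rel X' X" "gh_rel Y' Y"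
    using assms isometric_sym unfolding gh_rel_def by auto
  then show ?thesis using le assms by (simp add: order_antisym)
qed


section \<open>The Gromov--Hausdorff space\<close>

lemma compact_metric_singleton: "compact_metric (metric ({0 :: real}, dist))"
proof -
  interpret Metric_space "{0 :: real}" dist
    by unfold_locales (auto simp: dist_commute)
  have "compact_space mtopology"
    unfolding compact_space_def by (rule finite_imp_compactin) auto
  then show ?thesis unfolding compact_metric_def by simp
qed

quotient_type gh_space = "real metric" / partial: gh_rel
proof (rule part_equivpI)
  show "\<exists>X. gh_rel X X"
    using compact_metric_singleton isometric_refl unfolding gh_rel_def by blast
  show "symp gh_rel" using isometric_sym unfolding gh_rel_def by (auto intro!: sympI)
  show "transp gh_rel" using isometric_trans unfolding gh_rel_def by (blast intro: transpI)
qed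

instantiation gh_space :: metric_space
begin

lift_definition dist_gh_space :: "gh_space \<Rightarrow> gh_space \<Rightarrow> real" is gh_dist
  by (rule gh_dist_cong)

definition uniformity_gh_space :: "(gh_space \<times> gh_space) filter" where
  "uniformity_gh_space = (INF e\<in>{0 <..}. principal {(x, y). dist x y < e})"

definition open_gh_space :: "gh_space set \<Rightarrow> bool" where
  "open_gh_space U = (\<forall>x\<in>U. \<forall>\<^sub>F (x', y) in uniformity. x' = x \<longrightarrow> y \<in> U)"

instance
proof
  show "dist x y = 0 \<longleftrightarrow> x = y" for x y :: gh_space
    by transfer
      (use gh_dist_0_of_isometric isometric_of_gh_dist_0 in \<open>auto simp: gh_rel_def\<close>)
  show "dist x y \<le> dist x z + dist y z" for x y z :: gh_space
    by transfer (metis gh_dist_triangle gh_dist_commute gh_rel_def)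
qed (rule uniformity_gh_space_def open_gh_space_def)+

end

lemma seq_dominated_isometric:
  assumes "isometric X Y" "seq_dominated S X"
  shows "seq_dominated S Y"
  unfolding seq_dominated_def
proof
  fix s assume "s \<in> S"
  then obtain E where "\<forall>n. E n \<subseteq> mspace X" "(\<Union>n. E n) = mspace X"
    "\<forall>n. mdiam X (E n) < ennreal (s n)"
    using assms(2)[unfolded seq_dominated_def] by (metis (no_types, lifting))
  then have E: "\<And>n. E n \<subseteq> mspace X" "(\<Union>n. E n) = mspace X"
    "\<And>n. mdiam X (E n) < ennreal (s n)"
    by auto
  obtain f where f: "isometric_embedding X Y f" "f ` mspace X = mspace Y"
    using assms(1)[unfolded isometric_def] by (elim exE conjE)
  have diam: "mdiam Y (f ` E n) = mdiam X (E n)" for n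
  proof -
    have eq: "mdist Y (f x) (f y) = mdist X x y" if "x \<in> E n" "y \<in> E n" for x y
      using f(1) E(1)[of n] that unfolding isometric_embedding_def by (simp add: subset_iff)
    have "mdiam Y (f ` E n) = (SUP x\<in>E n. SUP y\<in>E n. ennreal (mdist Y (f x) (f y)))"
      unfolding mdiam_def by (simp only: image_image)
    also have "\<dots> = mdiam X (E n)"
      unfolding mdiam_def using eq by (intro SUP_cong refl) simp
    finally show ?thesis .
  qed
  show "\<exists>E. (\<forall>n. E n \<subseteq> mspace Y) \<and> (\<Union>n. E n) = mspace Y \<and> (\<forall>n. mdiam Y (E n) < ennreal (s n))"
  proof (intro exI[of _ "\<lambda>n. f ` E n"] conjI allI)
    show "(\<Union>n. f ` E n) = mspace Y"
      using f(2) E(2) by (simp only: image_UN[symmetric])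
    show "f ` E n \<subseteq> mspace Y" for n
      using image_mono[OF E(1), of f n] f(2) by simp
    show "mdiam Y (f ` E n) < ennreal (s n)" for n
      using E(3) by (simp only: diam)
  qed
qed

lift_definition gh_seq_dominated :: "(nat \<Rightarrow> real) set \<Rightarrow> gh_space \<Rightarrow> bool" is seq_dominated
  unfolding gh_rel_def by (metis seq_dominated_isometric isometric_sym)

end

theory Submission
  imports Defs
begin

text \<open>
  For a single positive sequence \<open>s\<close>, the \<open>s\<close>-dominated spaces contain a dense open set, because
  finite spaces are dense and everything near a finite space is \<open>s\<close>-dominated. Indeed, if \<open>X\<close> has
  \<open>m\<close> points and a compact space \<open>Y\<close> is closer to \<open>X\<close> than a quarter of the smallest of the first
  \<open>m\<close> terms of \<open>s\<close>, then a correspondence between \<open>X\<close> and \<open>Y\<close> cuts \<open>Y\<close> into the \<open>m\<close> sets of points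
  that correspond to a given point of \<open>X\<close>, and the diameters of these sets are bounded by the
  distortion, hence smaller than the first \<open>m\<close> terms of \<open>s\<close>; this is
  \<open>seq_dominated_near_finite\<close>. Density of the finite spaces is \<open>finite_space_near\<close>: a finite net in a
  compact space is Gromov--Hausdorff close to that space.

  Domination for a family only gets stronger when the family is replaced by a finer one. A countably
  determined family therefore needs only the countably many dense open sets that belong to the
  members of a finer countable family, and their intersection is comeager.
\<close>

section \<open>Comeager sets\<close>

lemma nowhere_dense_subset_Compl:
  assumes "open U" "closure U = UNIV" "A \<subseteq> - U"
  shows "nowhere_dense A"
proof -
  have "closure A \<subseteq> - U"
    using assms(1,3) by (simp add: closure_minimal closed_Compl)
  then have "interior (closure A) \<subseteq> interior (- U)"
    by (rule interior_mono)
  also have "\<dots> = {}"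
    using assms(2) by (simp add: interior_complement)
  finally show ?thesis
    unfolding nowhere_dense_def by simp
qed

lemma comeager_if_dense_open_family:
  fixes A :: "'a::topological_space set"
  assumes count: "countable \<U>" and sub: "\<Inter>\<U> \<subseteq> A"
    and dense_open: "\<And>U. U \<in> \<U> \<Longrightarrow> open U \<and> closure U = UNIV"
  shows "comeager A"
proof -
  \<comment> \<open>Adding the whole space makes the family nonempty, so that a sequence can enumerate it.\<close>
  define U where "U = from_nat_into (insert UNIV \<U>)"
  have range: "range U = insert UNIV \<U>"
    unfolding U_def using count by (intro range_from_nat_into) auto
  have "U n = UNIV \<or> U n \<in> \<U>" for n
    using range by blast
  then have "open (U n)" "closure (U n) = UNIV" for n
    using dense_open by (metis open_UNIV, metis closure_UNIV)
  then have "nowhere_dense (- A \<inter> - U n)" for n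
    by (rule nowhere_dense_subset_Compl) auto
  moreover have "(\<Inter>n. U n) \<subseteq> A"
    using sub range by auto
  then have "- A = (\<Union>n. - A \<inter> - U n)"
    by blast
  ultimately show ?thesis
    unfolding comeager_def meager_def by (intro exI[of _ "\<lambda>n. - A \<inter> - U n"]) simp
qed


section \<open>Finite metric spaces\<close>

text \<open>An \<open>e\<close>-net, with the relation that joins each of its points to the points within distance \<open>e\<close>,
  is a correspondence of distortion at most \<open>2 * e\<close> by two applications of the triangle inequality.\<close>

lemma finite_space_near:
  assumes X: "compact_metric X" and e: "0 < e"
  obtains F where "compact_metric F" "finite (mspace F)" "gh_dist F X \<le> e"
proof -
  interpret Metric_space "mspace X" "mdist X" by simp
  have "compactin mtopology (mspace X)"
    using X unfolding compact_metric_def mtopology_of_def compact_space_def by simp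
  then have "mtotally_bounded (mspace X)"
    by (rule compactin_imp_mtotally_bounded)
  then have "\<exists>N. finite N \<and> N \<subseteq> mspace X \<and> mspace X \<subseteq> (\<Union>x\<in>N. mball x e)"
    using e by (simp only: mtotally_bounded_def)
  then obtain N where N: "finite N" "N \<subseteq> mspace X" "mspace X \<subseteq> (\<Union>x\<in>N. mball x e)"
    by (elim exE conjE)
  define F where "F = submetric X N"
  have F: "mspace F = N" "mdist F = mdist X"
    using N(2) by (auto simp: F_def)
  have "compactin (mtopology_of F) N"
    using N(1) F by (intro finite_imp_compactin) auto
  moreover have "N \<noteq> {}"
    using X N(3) unfolding compact_metric_def by auto
  ultimately have cF: "compact_metric F"
    unfolding compact_metric_def compact_space_def by (simp add: F)
  have "gh_corr F X (2 * e) {(y, x). y \<in> N \<and> x \<in> mball y e}"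
  proof (rule gh_corrI)
    show "\<exists>x. (y, x) \<in> {(y, x). y \<in> N \<and> x \<in> mball y e}" if "y \<in> mspace F" for y
      using that N(2) e F by (intro exI[of _ y]) auto
    show "\<exists>y. (y, x) \<in> {(y, x). y \<in> N \<and> x \<in> mball y e}" if "x \<in> mspace X" for x
      using subsetD[OF N(3) that] by blast
    fix y x y' x'
    assume "(y, x) \<in> {(y, x). y \<in> N \<and> x \<in> mball y e}" "(y', x') \<in> {(y, x). y \<in> N \<and> x \<in> mball y e}"
    then have m: "y \<in> mspace X" "y' \<in> mspace X" "x \<in> mspace X" "x' \<in> mspace X"
      and lt: "mdist X y x < e" "mdist X y' x' < e"
      using N(2) by auto
    have "mdist X y y' \<le> mdist X y x + mdist X x y'" "mdist X x y' \<le> mdist X x x' + mdist X x' y'"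
      "mdist X x x' \<le> mdist X x y + mdist X y x'" "mdist X y x' \<le> mdist X y y' + mdist X y' x'"
      using m by (auto intro: triangle)
    then show "\<bar>mdist F y y' - mdist X x x'\<bar> \<le> 2 * e"
      unfolding F using lt commute[of x y] commute[of x' y'] by linarith
  qed (use N F in auto)
  then have "gh_dist F X \<le> e"
    using gh_dist_le_corr[OF cF X _ e] by blast
  then show ?thesis
    using that[OF cF] N(1) F by simp
qed

lemma mdiam_le:
  assumes "\<And>x y. x \<in> E \<Longrightarrow> y \<in> E \<Longrightarrow> mdist K x y \<le> d"
  shows "mdiam K E \<le> ennreal d"
  unfolding mdiam_def using assms by (intro SUP_least ennreal_leI)

text \<open>Only as many pieces as \<open>X\<close> has points are needed to cover \<open>Y\<close>; empty sets, of diameter \<open>0\<close>,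
  fill up the rest of the covering sequence. This is why \<open>r\<close> can depend on finitely many terms
  of \<open>s\<close> and still be positive.\<close>

lemma seq_dominated_near_finite:
  assumes X: "compact_metric X" and fin: "finite (mspace X)" and pos: "\<And>n. 0 < s n"
  obtains r where "0 < r"
    "\<And>Y. compact_metric Y \<Longrightarrow> gh_dist X Y < r \<Longrightarrow> seq_dominated {s} Y"
proof -
  obtain a m where a: "mspace X = a ` {i. i < (m :: nat)}"
    using finite_imp_nat_seg_image_inj_on[OF fin] by blast
  then have m: "0 < m"
    using X unfolding compact_metric_def by (cases m) auto
  \<comment> \<open>At distance less than \<open>r\<close> the distortion is at most \<open>2 * r\<close>, which has to stay strictly below
    the first \<open>m\<close> terms.\<close>
  define r where "r = Min (s ` {..<m}) / 4"
  have "0 < Min (s ` {..<m})"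
    using m pos by (subst Min_gr_iff) auto
  then have r: "0 < r"
    unfolding r_def by simp
  have small: "2 * r < s i" if "i < m" for i
  proof -
    have "Min (s ` {..<m}) \<le> s i"
      using that by (intro Min_le) auto
    then show ?thesis using r pos[of i] unfolding r_def by linarith
  qed
  show ?thesis
  proof (rule that[OF r])
    fix Y assume Y: "compact_metric Y" and near: "gh_dist X Y < r"
    obtain R where R: "gh_corr X Y (2 * r) R"
      using gh_dist_less_corr[OF X Y near] by blast
    define E where "E = (\<lambda>i. if i < m then {y. (a i, y) \<in> R} else {})"
    have sub: "E i \<subseteq> mspace Y" for i
      using gh_corr_mem(2)[OF R] by (auto simp: E_def)
    have cover: "mspace Y \<subseteq> (\<Union>i. E i)"
    proof
      fix y assume "y \<in> mspace Y"
      then obtain x where x: "(x, y) \<in> R"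
        using gh_corr_right[OF R] by blast
      then obtain i where "i < m" "x = a i"
        using gh_corr_mem(1)[OF R x] a by auto
      then show "y \<in> (\<Union>i. E i)"
        using x by (auto simp: E_def)
    qed
    have diam: "mdiam Y (E i) < ennreal (s i)" for i
    proof (cases "i < m")
      case True
      have "mdist Y y y' \<le> 2 * r" if "y \<in> E i" "y' \<in> E i" for y y'
      proof -
        have yy': "(a i, y) \<in> R" "(a i, y') \<in> R"
          using that True by (auto simp: E_def)
        have "mdist X (a i) (a i) = 0"
          using gh_corr_mem(1)[OF R yy'(1)] by simp
        then show ?thesis
          using gh_corr_D[OF R yy'] by linarith
      qed
      then have "mdiam Y (E i) \<le> ennreal (2 * r)"
        by (rule mdiam_le)
      also have "\<dots> < ennreal (s i)"
        using small[OF True] r by (intro ennreal_lessI pos)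
      finally show ?thesis .
    next
      case False
      then show ?thesis
        using pos[of i] by (simp add: E_def mdiam_def bot_ennreal)
    qed
    show "seq_dominated {s} Y"
      unfolding seq_dominated_def
    proof (intro ballI exI[of _ E] conjI allI)
      show "(\<Union>i. E i) = mspace Y"
        using sub cover by blast
    qed (use sub diam in auto)
  qed
qed


section \<open>Domination in the Gromov--Hausdorff space\<close>

lemma gh_rel_refl: "compact_metric X \<Longrightarrow> gh_rel X X"
  unfolding gh_rel_def using isometric_refl by blast

lemma gh_space_cases:
  obtains X where "compact_metric X" "K = abs_gh_space X"
  by (metis Quotient3_abs_rep Quotient3_gh_space Quotient3_rep_reflp gh_rel_def)

lemma dist_abs_gh_space:
  assumes "compact_metric X" "compact_metric Y"
  shows "dist (abs_gh_space X) (abs_gh_space Y) = gh_dist X Y"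
  using assms by (intro dist_gh_space.abs_eq gh_rel_refl)

lemma gh_seq_dominated_abs:
  assumes "compact_metric X"
  shows "gh_seq_dominated S (abs_gh_space X) \<longleftrightarrow> seq_dominated S X"
  using assms by (intro gh_seq_dominated.abs_eq gh_rel_refl)

text \<open>The interior contains a ball around every finite space, and the finite spaces are dense.\<close>

lemma closure_interior_dominated:
  assumes pos: "\<And>n. 0 < s n"
  shows "closure (interior {K. gh_seq_dominated {s} K}) = UNIV"
proof -
  have "\<exists>L\<in>interior {K. gh_seq_dominated {s} K}. dist L K < e" if e: "0 < e" for K e
  proof -
    obtain X where X: "compact_metric X" "K = abs_gh_space X"
      by (rule gh_space_cases)
    obtain F where F: "compact_metric F" "finite (mspace F)" "gh_dist F X \<le> e / 2"
      using finite_space_near[OF X(1), of "e / 2"] e by auto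
    obtain r where r: "0 < r"
      "\<And>Y. compact_metric Y \<Longrightarrow> gh_dist F Y < r \<Longrightarrow> seq_dominated {s} Y"
      using seq_dominated_near_finite[of F s, OF F(1,2) pos] by blast
    have "ball (abs_gh_space F) r \<subseteq> {K. gh_seq_dominated {s} K}"
    proof
      fix L assume L: "L \<in> ball (abs_gh_space F) r"
      obtain Y where Y: "compact_metric Y" "L = abs_gh_space Y"
        by (rule gh_space_cases)
      then show "L \<in> {K. gh_seq_dominated {s} K}"
        using L r(2)[OF Y(1)] by (simp add: dist_abs_gh_space F(1) gh_seq_dominated_abs)
    qed
    then have "abs_gh_space F \<in> interior {K. gh_seq_dominated {s} K}"
      using r(1) by (intro interiorI[of "ball (abs_gh_space F) r"]) auto
    moreover have "dist (abs_gh_space F) K < e"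
      using F(3) e by (simp add: X dist_abs_gh_space F(1))
    ultimately show ?thesis by blast
  qed
  then show ?thesis
    by (auto simp: closure_approachable)
qed

lemma seq_dominated_finer_family:
  assumes fine: "finer_family S' S" and dom: "\<And>s. s \<in> S' \<Longrightarrow> seq_dominated {s} K"
  shows "seq_dominated S K"
  unfolding seq_dominated_def
proof
  fix s assume s: "s \<in> S"
  obtain s' where s': "s' \<in> S'" "s' \<le> s"
    using bspec[OF fine[unfolded finer_family_def] s] by (elim bexE)
  obtain E where E: "\<forall>n. E n \<subseteq> mspace K" "(\<Union>n. E n) = mspace K"
    "\<forall>n. mdiam K (E n) < ennreal (s' n)"
    using bspec[OF dom[OF s'(1), unfolded seq_dominated_def] singletonI] by (elim exE conjE)
  have "\<forall>n. mdiam K (E n) < ennreal (s n)"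
    using E(3) s'(2) by (meson ennreal_leI le_funD less_le_trans)
  with E(1,2) show "\<exists>E. (\<forall>n. E n \<subseteq> mspace K) \<and> (\<Union>n. E n) = mspace K \<and> (\<forall>n. mdiam K (E n) < ennreal (s n))"
    by (intro exI[of _ E] conjI)
qed

theorem theorem9p2:
  fixes S :: "(nat \<Rightarrow> real) set"
  assumes "S \<subseteq> null_seqs"
    and "countably_determined S"
  shows "comeager {K :: gh_space. gh_seq_dominated S K}"
proof -
  obtain S' where S': "S' \<subseteq> null_seqs" "countable S'" "finer_family S' S"
    using assms(2) unfolding countably_determined_def by (elim exE conjE)
  define U where "U = (\<lambda>s. interior {K :: gh_space. gh_seq_dominated {s} K})"
  show ?thesis
  proof (rule comeager_if_dense_open_family[of "U ` S'"])
    show "countable (U ` S')"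
      using S'(2) by simp
    show "\<Inter> (U ` S') \<subseteq> {K. gh_seq_dominated S K}"
    proof
      fix K assume K: "K \<in> \<Inter> (U ` S')"
      obtain X where X: "compact_metric X" "K = abs_gh_space X"
        by (rule gh_space_cases)
      have dom: "seq_dominated {s} X" if "s \<in> S'" for s
        using that K X interior_subset[of "{K. gh_seq_dominated {s} K}"]
        by (auto simp: U_def gh_seq_dominated_abs)
      show "K \<in> {K. gh_seq_dominated S K}"
        using seq_dominated_finer_family[OF S'(3) dom] X by (simp add: gh_seq_dominated_abs)
    qed
    show "open V \<and> closure V = UNIV" if "V \<in> U ` S'" for V
      using that S'(1) by (auto simp: U_def null_seqs_def closure_interior_dominated)
  qed
qed

end
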